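(* Let $V,\Lambda,\mu_s,\mu_o,w_s,K>0$ with $V\ge\overline{C}_s:=\frac{w_s}{\mu_s}+2\sqrt{\frac{w_s}{\Lambda\mu_s}}$, and suppose $(w_s,K)\in\mathcal H$, i.e. the optimal service deployment is to operate both services. Compared to System S (standard service only), the hybrid model with two services reduces the price while increasing the lead time of the standard service: if $p_s^*,W_s^*$ denote the price and lead time of the standard service in the optimal hybrid policy (with $\lambda_s^*,\lambda_o^*>0$) and $p_s^S,W_s^S$ those in the optimal policy of System S, then $p_s^*<p_s^S$ and $W_s^*>W_s^S$.
   Context: Customers arrive at rate $\Lambda$ and have types $\theta$ uniform on $[0,1]$. Service $i\in\{s,o\}$ (standard, on-demand) with price $p_i$ and lead time $W_i$ gives utility $U_i=V-p_i-\theta W_i$; each customer joins the service with the highest nonnegative utility or balks (each customer joins at most one service; if the two services are identical in price and lead time, any split is allowed). Hybrid model: the service provider chooses $p_s,p_o$, the number $k_s\ge0$ of employees (service rate $\mu_s$, hourly wage $w_s$), and the per-service wage $w_o$ of contractors (service rate $\mu_o$, pool size $K$, reservation rates $r$ uniform on $[0,1]$), to maximize $p_s\lambda_s-w_sk_s+p_o\lambda_o-\lambda_ow_o$ subject to $\lambda_s=\Lambda\Pr(U_s\ge0,U_s\ge U_o)$, $\lambda_o=\Lambda\Pr(U_o\ge0,U_o\ge U_s)$, $W_i=1/(k_i\mu_i-\lambda_i)$ with $k_i\mu_i>\lambda_i$, and $k_o=K\Pr(\lambda_ow_o/k_o\ge r)$ with the uniform distribution function taken as $x\mapsto x$, i.e.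 $k_o^2=K\lambda_ow_o$. A service may be not offered ($\lambda_i=k_i=0$, no cost). Regime $\mathcal H$ is the set of $(w_s,K)$ for which this problem has an optimal solution with both $\lambda_s^*>0$ and $\lambda_o^*>0$. System S: only the standard service is offered; the provider maximizes $p_s\lambda_s-w_sk_s$ with $\lambda_s=\Lambda\Pr(U_s\ge0)$, $W_s=1/(k_s\mu_s-\lambda_s)$, $k_s\mu_s>\lambda_s$ (when $V=\overline{C}_s$, where the optimum is not unique, the optimal policy with $\lambda_s=\Lambda$ is taken). *)

theory Defs
  imports "HOL-Probability.Probability"
begin

definition type_space :: "real measure" where
  "type_space = uniform_measure lborel {0..1}"

text \<open>All endogenous quantities of a service are fields of the record; they are tied together by
  the feasibility constraints below, so that a policy together with the equilibrium it induces is a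
  single object.\<close>

record service =
  price :: real
  lead_time :: real
  arrival_rate :: real
  servers :: real

record od_service = service +
  wage :: real

definition utility :: "real \<Rightarrow> 'a service_scheme \<Rightarrow> real \<Rightarrow> real" where
  "utility V x \<theta> = V - price x - \<theta> * lead_time x"

text \<open>A service that is not offered is \<open>None\<close>. In the last equation ties have probability zero
  unless the two services agree in price and lead time, in which case the split is arbitrary.\<close>

fun demand :: "real \<Rightarrow> real \<Rightarrow> service option \<Rightarrow> od_service option \<Rightarrow> bool" where
  "demand V \<Lambda> None None \<longleftrightarrow> True"
| "demand V \<Lambda> (Some s) None \<longleftrightarrow>
     arrival_rate s = \<Lambda> * \<P>(\<theta> in type_space. 0 \<le> utility V s \<theta>)"
| "demand V \<Lambda> None (Some d) \<longleftrightarrow>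
     arrival_rate d = \<Lambda> * \<P>(\<theta> in type_space. 0 \<le> utility V d \<theta>)"
| "demand V \<Lambda> (Some s) (Some d) \<longleftrightarrow>
     (if price s = price d \<and> lead_time s = lead_time d
      then 0 \<le> arrival_rate s \<and> 0 \<le> arrival_rate d \<and>
           arrival_rate s + arrival_rate d = \<Lambda> * \<P>(\<theta> in type_space. 0 \<le> utility V s \<theta>)
      else arrival_rate s =
             \<Lambda> * \<P>(\<theta> in type_space. 0 \<le> utility V s \<theta> \<and> utility V d \<theta> \<le> utility V s \<theta>) \<and>
           arrival_rate d =
             \<Lambda> * \<P>(\<theta> in type_space. 0 \<le> utility V d \<theta> \<and> utility V s \<theta> \<le> utility V d \<theta>))"

definition queue :: "real \<Rightarrow> 'a service_scheme \<Rightarrow> bool" where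
  "queue \<mu> x \<longleftrightarrow> arrival_rate x < servers x * \<mu> \<and>
     lead_time x = 1 / (servers x * \<mu> - arrival_rate x)"

definition std_operation :: "real \<Rightarrow> service \<Rightarrow> bool" where
  "std_operation \<mu>s s \<longleftrightarrow> 0 \<le> servers s \<and> queue \<mu>s s"

text \<open>The last conjunct is the participation condition of the contractors, where the distribution
  function of the reservation rate is taken to be the identity. For a nonnegative arrival rate and
  positive \<open>\<mu>o\<close> the stability condition makes the number of servers positive, so the
  division is never by zero.\<close>

definition od_operation :: "real \<Rightarrow> real \<Rightarrow> od_service \<Rightarrow> bool" where
  "od_operation \<mu>o K d \<longleftrightarrow> queue \<mu>o d \<and>
     servers d = K * (arrival_rate d * wage d / servers d)"

definition std_profit :: "real \<Rightarrow> service \<Rightarrow> real" where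
  "std_profit ws s = price s * arrival_rate s - ws * servers s"

definition od_profit :: "od_service \<Rightarrow> real" where
  "od_profit d = price d * arrival_rate d - arrival_rate d * wage d"

type_synonym policy = "service option \<times> od_service option"

definition hybrid_feasible ::
    "real \<Rightarrow> real \<Rightarrow> real \<Rightarrow> real \<Rightarrow> real \<Rightarrow> policy \<Rightarrow> bool" where
  "hybrid_feasible V \<Lambda> \<mu>s \<mu>o K h \<longleftrightarrow>
     demand V \<Lambda> (fst h) (snd h) \<and>
     pred_option (std_operation \<mu>s) (fst h) \<and>
     pred_option (od_operation \<mu>o K) (snd h)"

definition hybrid_profit :: "real \<Rightarrow> policy \<Rightarrow> real" where
  "hybrid_profit ws h =
     (case fst h of None \<Rightarrow> 0 | Some s \<Rightarrow> std_profit ws s) +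
     (case snd h of None \<Rightarrow> 0 | Some d \<Rightarrow> od_profit d)"

definition hybrid_optimal ::
    "real \<Rightarrow> real \<Rightarrow> real \<Rightarrow> real \<Rightarrow> real \<Rightarrow> real \<Rightarrow> policy \<Rightarrow> bool" where
  "hybrid_optimal V \<Lambda> \<mu>s \<mu>o ws K h \<longleftrightarrow>
     is_arg_max (hybrid_profit ws) (hybrid_feasible V \<Lambda> \<mu>s \<mu>o K) h"

definition regime_H :: "real \<Rightarrow> real \<Rightarrow> real \<Rightarrow> real \<Rightarrow> (real \<times> real) set" where
  "regime_H V \<Lambda> \<mu>s \<mu>o = {(ws, K). \<exists>s d.
     hybrid_optimal V \<Lambda> \<mu>s \<mu>o ws K (Some s, Some d) \<and>
     0 < arrival_rate s \<and> 0 < arrival_rate d}"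

definition systemS_feasible :: "real \<Rightarrow> real \<Rightarrow> real \<Rightarrow> service \<Rightarrow> bool" where
  "systemS_feasible V \<Lambda> \<mu>s s \<longleftrightarrow> demand V \<Lambda> (Some s) None \<and> std_operation \<mu>s s"

definition C_bar :: "real \<Rightarrow> real \<Rightarrow> real \<Rightarrow> real" where
  "C_bar \<Lambda> \<mu>s ws = ws / \<mu>s + 2 * sqrt (ws / (\<Lambda> * \<mu>s))"

text \<open>For \<open>V = C_bar \<Lambda> \<mu>s ws\<close> the maximizer is not unique, and the one serving all
  customers is selected.\<close>

definition systemS_optimal ::
    "real \<Rightarrow> real \<Rightarrow> real \<Rightarrow> real \<Rightarrow> service \<Rightarrow> bool" where
  "systemS_optimal V \<Lambda> \<mu>s ws s \<longleftrightarrow>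
     is_arg_max (std_profit ws) (systemS_feasible V \<Lambda> \<mu>s) s \<and>
     (V = C_bar \<Lambda> \<mu>s ws \<longrightarrow> arrival_rate s = \<Lambda>)"

end

theory Submission
  imports Defs
begin

text \<open>Lengthen the lead time of the standard service slightly and adjust the prices so that all
  customers keep their choices. Since this must not pay off, \<open>ws / \<mu>s \<le> \<Lambda> * c * W\<^sup>2\<close>
  for the standard lead time \<open>W\<close>, where \<open>c < 1\<close> is the square of the share served by the
  standard service if it is not the faster one, and a difference of two squares of shares if it is
  the faster one. System S serves everybody with lead time \<open>sqrt (ws / (\<mu>s * \<Lambda>))\<close> at the
  price that leaves the most impatient customer indifferent, and the inequality for \<open>W\<close>
  puts the hybrid policy on the other side of both numbers.\<close>

section \<open>Choice probabilities for uniformly distributed types\<close>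

lemma prob_type_space_interval:
  assumes "Measurable.pred borel Q" "0 \<le> l" "u \<le> 1"
    and "\<And>\<theta>. 0 \<le> \<theta> \<Longrightarrow> \<theta> \<le> 1 \<Longrightarrow> Q \<theta> \<longleftrightarrow> l \<le> \<theta> \<and> \<theta> \<le> u"
  shows "\<P>(\<theta> in type_space. Q \<theta>) = max 0 (u - l)"
proof -
  have "{\<theta> \<in> space lborel. Q \<theta>} \<in> sets lborel"
    using assms(1) by measurable
  then have "\<P>(\<theta> in type_space. Q \<theta>) = measure lborel ({0..1} \<inter> {\<theta>. Q \<theta>})"
    by (simp add: type_space_def measure_uniform_measure)
  also have "{0..1} \<inter> {\<theta>. Q \<theta>} = {l..u}"
    using assms(2-4) by auto
  finally show ?thesis by simp
qed

lemma prob_join_single: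
  assumes "0 < lead_time x"
  shows "\<P>(\<theta> in type_space. 0 \<le> utility V x \<theta>) = max 0 (min 1 ((V - price x) / lead_time x))"
  using prob_type_space_interval[of "\<lambda>\<theta>. 0 \<le> utility V x \<theta>" 0 "min 1 ((V - price x) / lead_time x)"]
    assms by (simp add: utility_def le_divide_eq algebra_simps)

text \<open>With positive shares, the slower service \<open>x\<close> takes the patient types up to
  the indifferent one, and \<open>y\<close> those from there to the last type served. The
  equivalence serves both ways: it extracts equations from an optimal policy and certifies the
  demand of a perturbed one.\<close>

lemma prob_join_slow_fast_iff:
  assumes "lead_time y < lead_time x" "0 < lead_time y" "0 < qx" "0 < qy"
  shows "\<P>(\<theta> in type_space. 0 \<le> utility V x \<theta> \<and> utility V y \<theta> \<le> utility V x \<theta>) = qx \<and>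
      \<P>(\<theta> in type_space. 0 \<le> utility V y \<theta> \<and> utility V x \<theta> \<le> utility V y \<theta>) = qy \<longleftrightarrow>
    price y - price x = qx * (lead_time x - lead_time y) \<and>
      qx + qy = min 1 ((V - price y) / lead_time y)" (is "?Px = qx \<and> ?Py = qy \<longleftrightarrow> ?R")
proof -
  define t where "t = (price y - price x) / (lead_time x - lead_time y)"
  define mx where "mx = (V - price x) / lead_time x"
  define my where "my = (V - price y) / lead_time y"
  have t: "price y - price x = t * (lead_time x - lead_time y)"
    using assms by (simp add: t_def)
  have mx: "V - price x = mx * lead_time x" and my: "V - price y = my * lead_time y"
    using assms by (simp_all add: mx_def my_def)
  have pos: "0 < lead_time x" using assms by linarith
  have Ux: "0 \<le> utility V x \<theta> \<longleftrightarrow> \<theta> \<le> mx" for \<theta>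
    using mx pos by (simp add: utility_def)
  have Uy: "0 \<le> utility V y \<theta> \<longleftrightarrow> \<theta> \<le> my" for \<theta>
    using my assms by (simp add: utility_def)
  have diff: "utility V x \<theta> - utility V y \<theta> = (t - \<theta>) * (lead_time x - lead_time y)" for \<theta>
    using t by (simp add: utility_def algebra_simps)
  have xy: "utility V y \<theta> \<le> utility V x \<theta> \<longleftrightarrow> \<theta> \<le> t" for \<theta>
  proof -
    have "utility V y \<theta> \<le> utility V x \<theta> \<longleftrightarrow> 0 \<le> (t - \<theta>) * (lead_time x - lead_time y)"
      by (simp flip: diff)
    then show ?thesis using assms(1) by (auto simp: zero_le_mult_iff)
  qed
  have yx: "utility V x \<theta> \<le> utility V y \<theta> \<longleftrightarrow> t \<le> \<theta>" for \<theta>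
  proof -
    have "utility V x \<theta> \<le> utility V y \<theta> \<longleftrightarrow> (t - \<theta>) * (lead_time x - lead_time y) \<le> 0"
      by (simp flip: diff)
    then show ?thesis using assms(1) by (auto simp: mult_le_0_iff)
  qed
  have Px: "?Px = max 0 (min 1 (min mx t))"
    unfolding Ux xy by (subst prob_type_space_interval[where l=0 and u="min 1 (min mx t)"]) auto
  have Py: "?Py = max 0 (min 1 my - max 0 t)"
    unfolding Uy yx
    by (subst prob_type_space_interval[where l="max 0 t" and u="min 1 my"]) auto
  \<comment> \<open>Both utilities agree at the indifferent type \<open>t\<close>, so either both
    services are acceptable to it or neither is. Hence \<open>mx\<close> drops out of
    \<open>?Px\<close>.\<close>
  have mxt: "t \<le> mx" if "t \<le> my"
  proof -
    have "(mx - t) * lead_time x = (my - t) * lead_time y"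
      using t mx my by (simp add: algebra_simps)
    moreover have "0 \<le> (my - t) * lead_time y" using that assms by simp
    ultimately show ?thesis using pos zero_le_mult_iff[of "mx - t" "lead_time x"] by auto
  qed
  have "?R \<longleftrightarrow> t = qx \<and> qx + qy = min 1 my"
    using assms(1) by (simp add: t my_def)
  also have "\<dots> \<longleftrightarrow> ?Px = qx \<and> ?Py = qy"
    unfolding Px Py using assms(3,4) mxt by (auto simp: max_def min_def split: if_splits)
  finally show ?thesis by blast
qed

section \<open>Lengthening the standard lead time at constant demand\<close>

lemma queue_lead_time_pos:
  assumes "queue \<mu> x"
  shows "0 < lead_time x"
  using assms by (simp add: queue_def)

lemma std_profit_eq:
  assumes "queue \<mu>s s" "0 < \<mu>s"
  shows "std_profit ws s =
    price s * arrival_rate s - ws / \<mu>s * (arrival_rate s + 1 / lead_time s)"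
proof -
  have "arrival_rate s + 1 / lead_time s = servers s * \<mu>s"
    using assms by (simp add: queue_def)
  then show ?thesis using assms(2) by (simp add: std_profit_def)
qed

text \<open>The value of \<open>servers\<close> solves the queue equation for lead time
  \<open>W\<close> at the unchanged arrival rate.\<close>

definition stretch_lead_time :: "real \<Rightarrow> real \<Rightarrow> real \<Rightarrow> service \<Rightarrow> service" where
  "stretch_lead_time \<mu> p W s = s\<lparr>price := p, lead_time := W,
     servers := (arrival_rate s + 1 / W) / \<mu>\<rparr>"

lemma stretch_lead_time_simps [simp]:
  "price (stretch_lead_time \<mu> p W s) = p"
  "lead_time (stretch_lead_time \<mu> p W s) = W"
  "arrival_rate (stretch_lead_time \<mu> p W s) = arrival_rate s"
  by (simp_all add: stretch_lead_time_def)

lemma queue_stretch_lead_time: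
  assumes "0 < \<mu>" "0 < W"
  shows "queue \<mu> (stretch_lead_time \<mu> p W s)"
  using assms by (simp add: stretch_lead_time_def queue_def)

lemma std_operation_stretch_lead_time:
  assumes "0 < \<mu>" "0 < W" "0 \<le> arrival_rate s"
  shows "std_operation \<mu> (stretch_lead_time \<mu> p W s)"
  using queue_stretch_lead_time[of \<mu> W p s] assms
  by (simp add: std_operation_def) (simp add: stretch_lead_time_def)

text \<open>The numbers \<open>u\<close> and \<open>v\<close> are the price cuts per unit of additional standard lead time
  that keep the demands constant, so that the first factor on the right is the marginal revenue loss.\<close>

lemma stretch_not_profitable:
  assumes "hybrid_optimal V \<Lambda> \<mu>s \<mu>o ws K (Some s, Some d)" "0 < \<mu>s" "0 < arrival_rate s" "0 < e"
    and dem: "demand V \<Lambda> (Some (stretch_lead_time \<mu>s (price s - u * e) (lead_time s + e) s))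
      (Some (d\<lparr>price := price d - v * e\<rparr>))"
  shows "ws / \<mu>s \<le>
    (u * arrival_rate s + v * arrival_rate d) * (lead_time s * (lead_time s + e))"
proof -
  let ?s = "stretch_lead_time \<mu>s (price s - u * e) (lead_time s + e) s"
  let ?d = "d\<lparr>price := price d - v * e\<rparr>"
  let ?W = "lead_time s"
  have feas: "hybrid_feasible V \<Lambda> \<mu>s \<mu>o K (Some s, Some d)"
    and max: "\<And>h. hybrid_feasible V \<Lambda> \<mu>s \<mu>o K h \<Longrightarrow>
      hybrid_profit ws h \<le> hybrid_profit ws (Some s, Some d)"
    using assms(1) by (auto simp: hybrid_optimal_def is_arg_max_def not_less)
  have q: "queue \<mu>s s" and od: "od_operation \<mu>o K d"
    using feas by (auto simp: hybrid_feasible_def std_operation_def)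
  have W: "0 < ?W" by (rule queue_lead_time_pos[OF q])
  have W': "0 < ?W + e" using W assms(4) by simp
  have "std_operation \<mu>s ?s"
    using W' assms(2,3) by (intro std_operation_stretch_lead_time) auto
  \<comment> \<open>Neither the queue nor the contractors' participation condition involves the
    price.\<close>
  moreover have "od_operation \<mu>o K ?d"
    using od by (simp add: od_operation_def queue_def)
  ultimately have "hybrid_profit ws (Some ?s, Some ?d) \<le> hybrid_profit ws (Some s, Some d)"
    using dem by (intro max) (simp add: hybrid_feasible_def)
  moreover have "std_profit ws ?s = (price s - u * e) * arrival_rate s
      - ws / \<mu>s * (arrival_rate s + 1 / (?W + e))"
    using std_profit_eq[OF queue_stretch_lead_time[OF assms(2) W'] assms(2)] by simp
  ultimately have "ws / \<mu>s * (1 / ?W - 1 / (?W + e)) \<le> (u * arrival_rate s + v * arrival_rate d) * e"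
    using std_profit_eq[OF q assms(2), of ws]
    by (simp add: hybrid_profit_def od_profit_def algebra_simps)
  moreover have "1 / ?W - 1 / (?W + e) = e / (?W * (?W + e))"
    using W W' by (simp add: field_simps)
  ultimately have "ws / \<mu>s * e / (?W * (?W + e)) \<le> (u * arrival_rate s + v * arrival_rate d) * e"
    by (simp only: times_divide_eq_right)
  then have "ws / \<mu>s * e \<le> (u * arrival_rate s + v * arrival_rate d) * e * (?W * (?W + e))"
    using W W' by (simp only: pos_divide_le_eq mult_pos_pos)
  then have "e * (ws / \<mu>s) \<le> e * ((u * arrival_rate s + v * arrival_rate d) * (?W * (?W + e)))"
    by (simp only: mult_ac)
  then show ?thesis using assms(4) by (simp only: mult_le_cancel_left_pos)
qed

text \<open>Lets the lengthening \<open>e\<close> tend to 0 from the right. The bound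
  \<open>\<delta>\<close> leaves room for keeping the order of the lead times.\<close>

lemma stretch_limit:
  fixes a c W \<delta> :: real
  assumes "0 < \<delta>" "\<And>e. 0 < e \<Longrightarrow> e < \<delta> \<Longrightarrow> a \<le> c * (W * (W + e))"
  shows "a \<le> c * W\<^sup>2"
proof (rule tendsto_lowerbound)
  have "((\<lambda>e. c * (W * (W + e))) \<longlongrightarrow> c * (W * (W + 0))) (at_right 0)"
    by (intro tendsto_intros)
  then show "((\<lambda>e. c * (W * (W + e))) \<longlongrightarrow> c * W\<^sup>2) (at_right 0)"
    by (simp add: power2_eq_square)
  show "\<forall>\<^sub>F e in at_right 0. a \<le> c * (W * (W + e))"
    unfolding eventually_at_right_field using assms by blast
qed simp

section \<open>Bounds for the standard service in the hybrid optimum\<close>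

lemma hybrid_std_bounds:
  fixes s :: service and d :: od_service
  assumes "0 < \<Lambda>" "0 < \<mu>s" "0 < ws"
    and opt: "hybrid_optimal V \<Lambda> \<mu>s \<mu>o ws K (Some s, Some d)"
    and pos: "0 < arrival_rate s" "0 < arrival_rate d"
  shows "price s < V - sqrt (ws / (\<mu>s * \<Lambda>)) \<and> sqrt (ws / (\<mu>s * \<Lambda>)) < lead_time s"
proof -
  define a where "a = sqrt (ws / (\<mu>s * \<Lambda>))"
  define x y where "x = arrival_rate s / \<Lambda>" and "y = arrival_rate d / \<Lambda>"
  define W w where "W = lead_time s" and "w = lead_time d"
  have rates: "arrival_rate s = \<Lambda> * x" "arrival_rate d = \<Lambda> * y" and xy: "0 < x" "0 < y"
    using assms by (simp_all add: x_def y_def)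
  have a: "0 < a" "a\<^sup>2 * \<Lambda> = ws / \<mu>s"
    using assms by (simp_all add: a_def)
  have dem: "demand V \<Lambda> (Some s) (Some d)" and q: "queue \<mu>s s" "queue \<mu>o d"
    using opt by (auto simp: hybrid_optimal_def is_arg_max_def hybrid_feasible_def
        std_operation_def od_operation_def)
  have W: "0 < W" "0 < w"
    using q queue_lead_time_pos by (auto simp: W_def w_def)
  \<comment> \<open>First-order condition in terms of the shares \<open>x\<close> and
    \<open>y\<close>, after division by \<open>\<Lambda>\<close>.\<close>
  have foc: "a\<^sup>2 \<le> (u * x + v * y) * W\<^sup>2"
    if "0 < \<delta>" and dem': "\<And>e. 0 < e \<Longrightarrow> e < \<delta> \<Longrightarrow>
      demand V \<Lambda> (Some (stretch_lead_time \<mu>s (price s - u * e) (W + e) s))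
        (Some (d\<lparr>price := price d - v * e\<rparr>))" for u v \<delta>
  proof -
    have "ws / \<mu>s \<le> (u * arrival_rate s + v * arrival_rate d) * W\<^sup>2"
      using stretch_limit[OF \<open>0 < \<delta>\<close>, of "ws / \<mu>s"]
        stretch_not_profitable[OF opt assms(2) pos(1)] dem' unfolding W_def by blast
    then have "a\<^sup>2 * \<Lambda> \<le> ((u * x + v * y) * W\<^sup>2) * \<Lambda>"
      using a rates by (simp add: algebra_simps)
    then show ?thesis using assms(1) by simp
  qed
  \<comment> \<open>Identical services belong to the slow case: any split satisfies its equations,
    and any lengthening makes the standard service strictly slower.\<close>
  consider (slow) "w \<le> W" "price d - price s = x * (W - w)" "x + y = min 1 ((V - price d) / w)"
    | (fast) "W < w" "price s - price d = y * (w - W)" "y + x = min 1 ((V - price s) / W)"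
  proof (cases "price s = price d \<and> lead_time s = lead_time d")
    case True
    then have "\<Lambda> * (x + y) = \<Lambda> * max 0 (min 1 ((V - price s) / lead_time s))"
      using dem rates prob_join_single[of s V] W by (simp add: W_def algebra_simps)
    then have "x + y = max 0 (min 1 ((V - price s) / lead_time s))"
      using assms(1) by simp
    then have "x + y = min 1 ((V - price d) / w)"
      using True xy by (auto simp: w_def max_def split: if_splits)
    then show ?thesis using True by (intro slow) (auto simp: W_def w_def)
  next
    case False
    have Ps: "\<P>(\<theta> in type_space. 0 \<le> utility V s \<theta> \<and> utility V d \<theta> \<le> utility V s \<theta>) = x"
      and Pd: "\<P>(\<theta> in type_space. 0 \<le> utility V d \<theta> \<and> utility V s \<theta> \<le> utility V d \<theta>) = y"
      using dem rates False assms(1) by (auto split: if_splits)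
    consider "w < W" | "W < w" | "W = w" by linarith
    then show ?thesis
    proof cases
      case 1
      then show ?thesis
        using prob_join_slow_fast_iff[of d s x y V] Ps Pd xy W slow by (simp add: W_def w_def)
    next
      case 2
      then show ?thesis
        using prob_join_slow_fast_iff[of s d y x V] Ps Pd xy W fast by (simp add: W_def w_def)
    next
      case 3
      \<comment> \<open>With equal lead times and different prices, nobody joins the dearer
        service.\<close>
      then have "price s < price d \<or> price d < price s"
        using False by (auto simp: W_def w_def)
      then have "x = 0 \<or> y = 0"
        using Ps Pd 3 by (auto simp: utility_def W_def w_def)
      then show ?thesis using xy by simp
    qed
  qed
  then show ?thesis
  proof cases
    case slow
    have "x + y \<le> (V - price d) / w" using slow(3) by simp
    then have pd: "(x + y) * w \<le> V - price d" using W by (simp add: le_divide_eq)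
    \<comment> \<open>Cutting only the standard price, at rate \<open>x\<close>, keeps type
      \<open>x\<close> indifferent.\<close>
    have "a\<^sup>2 \<le> (x * x + 0 * y) * W\<^sup>2"
    proof (rule foc[of 1])
      fix e :: real assume e: "0 < e"
      let ?s = "stretch_lead_time \<mu>s (price s - x * e) (W + e) s"
      let ?d = "d\<lparr>price := price d - 0 * e\<rparr>"
      have "price ?d - price ?s = x * (lead_time ?s - lead_time ?d)"
        using slow by (simp add: w_def algebra_simps)
      moreover have "lead_time ?d < lead_time ?s" using slow(1) e by (simp add: w_def)
      ultimately show "demand V \<Lambda> (Some ?s) (Some ?d)"
        using prob_join_slow_fast_iff[of ?d ?s x y V] slow(3) xy W rates by (simp add: w_def)
    qed simp
    then have "a\<^sup>2 \<le> (x * W)\<^sup>2" by (simp add: power2_eq_square mult_ac)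
    then have aW: "a \<le> x * W" by (rule power2_le_imp_le) (use xy W in simp)
    have "x < 1" using slow(3) xy by linarith
    then have "x * W < W" using W by simp
    moreover have "price s < V - a"
      using slow(2) pd aW mult_pos_pos[OF xy(2) W(2)] by (simp add: algebra_simps)
    ultimately show ?thesis using aW unfolding a_def W_def by linarith
  next
    case fast
    have "y + x \<le> (V - price s) / W" using fast(3) by simp
    then have ps: "(y + x) * W \<le> V - price s" using W by (simp add: le_divide_eq)
    \<comment> \<open>The rate \<open>y + x\<close> preserves the utility of the last type served.
      The indifferent type is \<open>y\<close>, so the on-demand price must fall at rate
      \<open>(y + x) - y = x\<close>. The requirement \<open>e < w - W\<close> keeps the standard
      service faster.\<close>
    have "a\<^sup>2 \<le> ((y + x) * x + x * y) * W\<^sup>2"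
    proof (rule foc[of "w - W"])
      fix e :: real assume e: "0 < e" "e < w - W"
      let ?s = "stretch_lead_time \<mu>s (price s - (y + x) * e) (W + e) s"
      let ?d = "d\<lparr>price := price d - x * e\<rparr>"
      have "price ?s - price ?d = y * (lead_time ?d - lead_time ?s)"
        using fast(2) by (simp add: w_def algebra_simps)
      moreover have "y + x = min 1 ((V - price ?s) / lead_time ?s)"
      proof (cases "y + x = 1")
        case True
        then show ?thesis using ps W e by (simp add: min_def le_divide_eq)
      next
        case False
        then have "y + x = (V - price s) / W" "y + x < 1"
          using fast(3) by (auto simp: min_def split: if_splits)
        then have "(y + x) * W = V - price s" "y + x < 1" using W by (simp_all add: field_simps)
        then have "(V - price ?s) / lead_time ?s = y + x"
          using W e by (simp add: field_simps)
        then show ?thesis using \<open>y + x < 1\<close> by simp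
      qed
      moreover have "lead_time ?s < lead_time ?d" "0 < lead_time ?s"
        using e W by (simp_all add: w_def)
      ultimately show "demand V \<Lambda> (Some ?s) (Some ?d)"
        using prob_join_slow_fast_iff[of ?s ?d y x V] xy rates by simp
    qed (use fast in simp)
    \<comment> \<open>The coefficient equals \<open>(y + x)\<^sup>2 - y\<^sup>2\<close>, so
      \<open>0 < y\<close> makes the bound strict.\<close>
    also have "\<dots> < ((y + x) * W)\<^sup>2"
      using xy W by (simp add: power2_eq_square algebra_simps)
    finally have aW: "a < (y + x) * W"
      by (rule power2_less_imp_less) (use xy W in simp)
    have "(y + x) * W \<le> W" using fast(3) W xy by (simp add: mult_left_le_one_le)
    then show ?thesis using aW ps unfolding a_def W_def by linarith
  qed
qed

section \<open>The optimum of System S\<close>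

lemma systemS_optimal_policy:
  assumes "0 < \<Lambda>" "0 < \<mu>s" "0 < ws" "C_bar \<Lambda> \<mu>s ws \<le> V"
    and opt: "systemS_optimal V \<Lambda> \<mu>s ws s"
  shows "V - sqrt (ws / (\<mu>s * \<Lambda>)) \<le> price s \<and> lead_time s = sqrt (ws / (\<mu>s * \<Lambda>))"
proof -
  define a where "a = sqrt (ws / (\<mu>s * \<Lambda>))"
  define C where "C = C_bar \<Lambda> \<mu>s ws"
  define W q where "W = lead_time s" and "q = arrival_rate s / \<Lambda>"
  have rate: "arrival_rate s = \<Lambda> * q" using assms by (simp add: q_def)
  have a: "0 < a" "ws / \<mu>s = \<Lambda> * a\<^sup>2"
    using assms by (simp_all add: a_def)
  have C: "C = ws / \<mu>s + 2 * a"
    by (simp add: C_def C_bar_def a_def mult.commute)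
  have feas: "systemS_feasible V \<Lambda> \<mu>s s"
    and max: "\<And>s'. systemS_feasible V \<Lambda> \<mu>s s' \<Longrightarrow> std_profit ws s' \<le> std_profit ws s"
    and full: "V = C \<Longrightarrow> q = 1"
    using opt assms(1) by (auto simp: systemS_optimal_def is_arg_max_def not_less q_def C_def)
  have queue: "queue \<mu>s s"
    using feas by (simp add: systemS_feasible_def std_operation_def)
  have W: "0 < W" using queue_lead_time_pos[OF queue] by (simp add: W_def)
  have q: "q = max 0 (min 1 ((V - price s) / W))"
    using feas prob_join_single[of s V] W assms(1)
    by (simp add: systemS_feasible_def W_def q_def)

  \<comment> \<open>The benchmark serves everybody, leaves type 1 with zero utility and earns
    \<open>\<Lambda> * (V - C)\<close>.\<close>
  let ?b = "stretch_lead_time \<mu>s (V - a) a (s\<lparr>arrival_rate := \<Lambda>\<rparr>)"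
  have "systemS_feasible V \<Lambda> \<mu>s ?b"
    using prob_join_single[of ?b V] std_operation_stretch_lead_time[OF assms(2) a(1)] a(1) assms(1)
    by (simp add: systemS_feasible_def)
  then have "std_profit ws ?b \<le> std_profit ws s" by (rule max)
  moreover have "std_profit ws ?b = (V - a) * \<Lambda> - \<Lambda> * a\<^sup>2 * (\<Lambda> + 1 / a)"
    using std_profit_eq[OF queue_stretch_lead_time[OF assms(2) a(1)] assms(2), where ws=ws, unfolded a(2)]
    by simp
  moreover have "(V - a) * \<Lambda> - \<Lambda> * a\<^sup>2 * (\<Lambda> + 1 / a) = \<Lambda> * (V - C)"
    using a(1) by (simp add: C a(2) field_simps power2_eq_square)
  moreover have "std_profit ws s = \<Lambda> * (price s * q - (\<Lambda> * a\<^sup>2) * q - a\<^sup>2 / W)"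
    using std_profit_eq[OF queue assms(2), of ws] rate a(2) by (simp add: W_def algebra_simps)
  ultimately have "\<Lambda> * (V - C) \<le> \<Lambda> * (price s * q - (\<Lambda> * a\<^sup>2) * q - a\<^sup>2 / W)"
    by simp
  then have le: "V - C \<le> price s * q - (\<Lambda> * a\<^sup>2) * q - a\<^sup>2 / W"
    using assms(1) by (simp only: mult_le_cancel_left_pos)
  have VC: "0 \<le> V - C" using assms(4) by (simp add: C_def)
  \<comment> \<open>Even without customers, a finite lead time costs capacity, so the profit would
    be negative.\<close>
  have "q \<noteq> 0"
  proof
    assume "q = 0"
    moreover have "0 < a\<^sup>2 / W" using a(1) W by simp
    ultimately show False using le VC by simp
  qed
  then have q01: "0 < q" "q \<le> 1" and "q \<le> (V - price s) / W"
    using q by linarith+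
  then have "price s \<le> V - q * W" using W by (simp add: le_divide_eq)
  then have "price s * q \<le> (V - q * W) * q" using q01 by (intro mult_right_mono) auto
  with le have "V - C \<le> (V - q * W) * q - (\<Lambda> * a\<^sup>2) * q - a\<^sup>2 / W" by linarith
  \<comment> \<open>Completing the square in \<open>q * W\<close> splits the loss against the
    benchmark into two nonnegative terms, which must both vanish.\<close>
  also have "\<dots> = q * (V - C) - (q * W - a)\<^sup>2 / W"
    using W by (simp add: C a(2) field_simps power2_eq_square)
  finally have loss: "(1 - q) * (V - C) + (q * W - a)\<^sup>2 / W \<le> 0"
    by (simp add: algebra_simps)
  have "0 \<le> (1 - q) * (V - C)" using q01 VC by simp
  moreover have "0 \<le> (q * W - a)\<^sup>2 / W" using W by simp
  ultimately have "(1 - q) * (V - C) = 0" and sq: "(q * W - a)\<^sup>2 / W = 0"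
    using loss by linarith+
  \<comment> \<open>If \<open>V = C\<close>, the product vanishes for every \<open>q\<close>, and
    the selection rule of \<open>systemS_optimal\<close> decides.\<close>
  then have "q = 1" using full by auto
  then have "W = a" using sq W by simp
  moreover have "V - a \<le> price s"
    using le \<open>q = 1\<close> \<open>W = a\<close> a(1) by (simp add: C a(2) power2_eq_square)
  ultimately show ?thesis by (simp add: a_def W_def)
qed

theorem theorem4:
  fixes V \<Lambda> \<mu>s \<mu>o ws K :: real
    and s sS :: service and d :: od_service
  assumes "0 < V" "0 < \<Lambda>" "0 < \<mu>s" "0 < \<mu>o" "0 < ws" "0 < K"
    and "C_bar \<Lambda> \<mu>s ws \<le> V"
    and "(ws, K) \<in> regime_H V \<Lambda> \<mu>s \<mu>o"
    and "hybrid_optimal V \<Lambda> \<mu>s \<mu>o ws K (Some s, Some d)"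
    and "0 < arrival_rate s" "0 < arrival_rate d"
    and "systemS_optimal V \<Lambda> \<mu>s ws sS"
  shows "price s < price sS \<and> lead_time sS < lead_time s"
  using hybrid_std_bounds[of \<Lambda> \<mu>s ws V \<mu>o K s d] systemS_optimal_policy[of \<Lambda> \<mu>s ws V sS] assms
  by linarith

end
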